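(* Let $\mathcal{A}\in T_{m,n}$ be a symmetric tensor, $q\in\mathbb{R}^n$, $p\in(0,1)$, $t>0$, and let $S_p^*$ be the set of local minimizers of $$\min_{u\in\mathbb{R}^n} f(u)=\tfrac12\|\Phi_{FB}(u)\|^2+t\|u\|_p^p .$$ Let $\mu$ be an upper bound of $S_p^*$, i.e. $\|u\|\le\mu$ for all $u\in S_p^*$. Let $u^*$ be any local minimizer of this problem satisfying $f(u^* )\le f(u_0)$ for an initial point $u_0\in\mathbb{R}^n$, and let $$L=\left(\frac{tp}{2\sqrt2\,\bigl(1+(m-1)\|\mathcal{A}\|\mu^{m-2}\bigr)\sqrt{f(u_0)}}\right)^{\frac{1}{1-p}} .$$ Then for any $i\in\{1,\ldots,n\}$, $$u_i^*\in(-L,L)\ \Longrightarrow\ u_i^*=0 .$$ Moreover, the number of nonzero entries of $u^*$ is at most $\dfrac{f(u_0)}{tL^p}$.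
   Context: $T_{m,n}$ is the set of real tensors $\mathcal{A}=(a_{i_1\ldots i_m})$ of order $m\ge 2$ and dimension $n$. $\mathcal{A}$ is symmetric if its entries $a_{i_1\ldots i_m}$ are invariant under all permutations of the indices. For $u\in\mathbb{R}^n$, $\mathcal{A}u^{m-1}\in\mathbb{R}^n$ is the vector with $(\mathcal{A}u^{m-1})_i=\sum_{i_2,\ldots,i_m=1}^n a_{i i_2\ldots i_m}u_{i_2}\cdots u_{i_m}$. $\|\mathcal{A}\|=\bigl(\sum_{i_1,\ldots,i_m}a_{i_1\ldots i_m}^2\bigr)^{1/2}$ is the Frobenius norm. The Fischer-Burmeister function is $\phi_{FB}(a,b)=\sqrt{a^2+b^2}-(a+b)$ for $a,b\in\mathbb{R}$, and $\Phi_{FB}:\mathbb{R}^n\to\mathbb{R}^n$ is defined by $\Phi_{FB}(u)_i=\phi_{FB}(u_i,(q+\mathcal{A}u^{m-1})_i)$, $i=1,\ldots,n$. On vectors, $\|\cdot\|$ is the Euclidean norm, and $\|u\|_p^p=\sum_{i=1}^n|u_i|^p$. *)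

theory Defs
  imports "HOL-Analysis.Analysis"
begin

text \<open>
  A tensor of order \<open>m\<close> and dimension \<open>CARD('n)\<close> is represented by its entries, indexed by the
  lists \<open>[i\<^sub>1, \<dots>, i\<^sub>m]\<close> over \<open>'n\<close>. All notions below take the order \<open>m\<close> as a parameter and look
  only at lists of length \<open>m\<close>; the values at lists of other lengths are irrelevant.
\<close>

type_synonym 'n tensor = "'n list \<Rightarrow> real"

lemma finite_index_lists: "finite {js :: 'n::finite list. length js = k}"
  using finite_lists_length_eq[of "UNIV :: 'n set" k] by simp

definition symmetric_tensor :: "nat \<Rightarrow> 'n tensor \<Rightarrow> bool" where
  "symmetric_tensor m A \<longleftrightarrow>
     (\<forall>\<pi> js. \<pi> permutes {..<m} \<longrightarrow> length js = m \<longrightarrow> A (permute_list \<pi> js) = A js)"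

definition frobenius_norm :: "nat \<Rightarrow> 'n::finite tensor \<Rightarrow> real" where
  "frobenius_norm m A = sqrt (\<Sum>js | length js = m. (A js)\<^sup>2)"

text \<open>The vector \<open>A u\<^sup>m\<^sup>-\<^sup>1\<close>; the list \<open>js\<close> is \<open>[i\<^sub>2, \<dots>, i\<^sub>m]\<close>.\<close>

definition tensor_apply :: "nat \<Rightarrow> 'n::finite tensor \<Rightarrow> real ^ 'n \<Rightarrow> real ^ 'n" where
  "tensor_apply m A u = (\<chi> i. \<Sum>js | length js = m - 1. A (i # js) * (\<Prod>j\<leftarrow>js. u $ j))"

definition phi_FB :: "real \<Rightarrow> real \<Rightarrow> real" where
  "phi_FB a b = sqrt (a\<^sup>2 + b\<^sup>2) - (a + b)"

definition Phi_FB :: "nat \<Rightarrow> 'n::finite tensor \<Rightarrow> real ^ 'n \<Rightarrow> real ^ 'n \<Rightarrow> real ^ 'n" where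
  "Phi_FB m A q u = (\<chi> i. phi_FB (u $ i) ((q + tensor_apply m A u) $ i))"

text \<open>\<open>\<parallel>u\<parallel>\<^sub>p\<^sup>p\<close>, for \<open>p > 0\<close>; vanishing components contribute \<open>0 powr p = 0\<close>.\<close>

definition p_norm_pow :: "real \<Rightarrow> real ^ 'n::finite \<Rightarrow> real" where
  "p_norm_pow p u = (\<Sum>i\<in>UNIV. \<bar>u $ i\<bar> powr p)"

definition FB_objective ::
    "nat \<Rightarrow> 'n::finite tensor \<Rightarrow> real ^ 'n \<Rightarrow> real \<Rightarrow> real \<Rightarrow> real ^ 'n \<Rightarrow> real" where
  "FB_objective m A q p t u = 1 / 2 * (norm (Phi_FB m A q u))\<^sup>2 + t * p_norm_pow p u"

definition local_minimizers :: "('a::topological_space \<Rightarrow> real) \<Rightarrow> 'a set" where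
  "local_minimizers f = {u. \<forall>\<^sub>F v in nhds u. f u \<le> f v}"

end

theory Submission
  imports Defs
begin

text \<open>
  Let \<open>u\<close> be a local minimizer with \<open>u\<^sub>i \<noteq> 0\<close>, and let \<open>v\<close> arise from \<open>u\<close> by moving the component
  \<open>u\<^sub>i\<close> a small distance \<open>s\<close> towards \<open>0\<close>. Since \<open>x \<mapsto> x\<^sup>p\<close> is concave for \<open>p < 1\<close>, the penalty
  drops by at least \<open>t p \<bar>u\<^sub>i\<bar>\<^sup>p\<^sup>-\<^sup>1 s\<close>, and local minimality forces the smooth part
  \<open>\<parallel>\<Phi>\<parallel>\<^sup>2 / 2\<close> to grow by at least as much. But \<open>\<Phi>\<close> is Lipschitz on bounded sets: with
  \<open>K = 2 (1 + (m - 1) \<parallel>A\<parallel> R\<^sup>m\<^sup>-\<^sup>2)\<close> on the ball of radius \<open>R\<close>, that growth is at most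
  \<open>K s \<parallel>\<Phi> u\<parallel> + O(s\<^sup>2)\<close>. Dividing by \<open>s\<close> and letting \<open>s \<rightarrow> 0\<close> gives the first-order condition
  \<open>t p \<bar>u\<^sub>i\<bar>\<^sup>p\<^sup>-\<^sup>1 \<le> K \<parallel>\<Phi> u\<parallel>\<close> (lemma \<open>local_minimizer_component_bound\<close>). Because \<open>p - 1 < 0\<close>,
  this is a lower bound on \<open>\<bar>u\<^sub>i\<bar>\<close>; with \<open>\<parallel>\<Phi> u\<parallel>\<^sup>2 \<le> 2 f u \<le> 2 f u\<^sub>0\<close> and \<open>R = \<mu>\<close> it becomes
  \<open>L \<le> \<bar>u\<^sub>i\<bar>\<close>. The count of nonzero entries follows, as each of them contributes at least
  \<open>t L\<^sup>p\<close> to \<open>f u\<close>.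

  Only Lipschitz estimates enter, no derivative of \<open>\<Phi>\<close>, which need not be differentiable.
  The constant comes from two sources: the Fischer--Burmeister function changes by at most twice
  the change of each argument (lemma \<open>phi_FB_lipschitz\<close>), and \<open>u \<mapsto> A u\<^sup>m\<^sup>-\<^sup>1\<close> has Lipschitz constant
  \<open>(m - 1) \<parallel>A\<parallel> R\<^sup>m\<^sup>-\<^sup>2\<close> (lemma \<open>tensor_apply_lipschitz\<close>), because it is the contraction of \<open>A\<close>
  with the tensor power \<open>u\<^sup>\<otimes>\<^sup>(\<^sup>m\<^sup>-\<^sup>1\<^sup>)\<close>.
\<close>

section \<open>Tensor powers of a vector\<close>

abbreviation index_lists :: "nat \<Rightarrow> 'n::finite list set" where
  "index_lists k \<equiv> {js. length js = k}"

abbreviation tensor_power :: "real ^ 'n \<Rightarrow> 'n list \<Rightarrow> real" where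
  "tensor_power u js \<equiv> (\<Prod>j\<leftarrow>js. u $ j)"

lemma sum_index_lists_Suc:
  fixes F :: "'n::finite list \<Rightarrow> real"
  shows "(\<Sum>js\<in>index_lists (Suc k). F js) = (\<Sum>j\<in>UNIV. \<Sum>js\<in>index_lists k. F (j # js))"
proof -
  have "bij_betw (\<lambda>(j, js). j # js) (UNIV \<times> index_lists k) (index_lists (Suc k) :: 'n list set)"
    by (auto simp: bij_betw_def inj_on_def image_iff length_Suc_conv)
  then have "(\<Sum>js\<in>index_lists (Suc k). F js) = (\<Sum>(j, js)\<in>UNIV \<times> index_lists k. F (j # js))"
    by (subst sum.reindex_bij_betw[symmetric]) (auto simp: case_prod_unfold)
  then show ?thesis
    by (simp add: sum.cartesian_product)
qed

lemma L2_set_index_lists_product: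
  fixes w :: "real ^ 'n::finite"
  shows "L2_set (\<lambda>js. w $ hd js * g (tl js)) (index_lists (Suc k))
    = norm w * L2_set g (index_lists k)"
proof -
  have "(\<Sum>js\<in>index_lists (Suc k). (w $ hd js * g (tl js))\<^sup>2)
      = (\<Sum>j\<in>UNIV. (w $ j)\<^sup>2) * (\<Sum>js\<in>index_lists k. (g js)\<^sup>2)"
    by (simp add: sum_index_lists_Suc power_mult_distrib sum_product)
  then show ?thesis
    by (simp add: L2_set_def norm_vec_def real_sqrt_mult)
qed

lemma L2_set_tensor_power:
  fixes u :: "real ^ 'n::finite"
  shows "L2_set (tensor_power u) (index_lists k) = norm u ^ k"
proof (induction k)
  case 0
  then show ?case by (simp add: L2_set_def)
next
  case (Suc k)
  have "L2_set (tensor_power u) (index_lists (Suc k))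
      = L2_set (\<lambda>js. u $ hd js * tensor_power u (tl js)) (index_lists (Suc k))"
    by (rule L2_set_cong) (auto simp: length_Suc_conv)
  with Suc show ?case
    using L2_set_index_lists_product[of u "tensor_power u" k] by simp
qed

text \<open>
  Telescoping: \<open>v \<otimes> V - u \<otimes> U = v \<otimes> (V - U) + (v - u) \<otimes> U\<close>, so replacing the factors \<open>u\<close> by
  \<open>v\<close> one at a time costs at most \<open>R\<^sup>k\<^sup>-\<^sup>1 \<parallel>v - u\<parallel>\<close> for each of the \<open>k\<close> factors.
\<close>
lemma L2_set_tensor_power_diff:
  fixes u v :: "real ^ 'n::finite"
  assumes u: "norm u \<le> R" and v: "norm v \<le> R"
  shows "L2_set (\<lambda>js. tensor_power v js - tensor_power u js) (index_lists k)
    \<le> real k * R ^ (k - 1) * norm (v - u)"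
proof (induction k)
  case 0
  then show ?case by (simp add: L2_set_def)
next
  case (Suc k)
  let ?D = "\<lambda>js. tensor_power v js - tensor_power u js"
  have R: "0 \<le> R" using u norm_ge_zero order_trans by blast
  have "L2_set ?D (index_lists (Suc k))
      = L2_set (\<lambda>js. v $ hd js * ?D (tl js) + (v - u) $ hd js * tensor_power u (tl js))
          (index_lists (Suc k))"
    by (rule L2_set_cong) (auto simp: length_Suc_conv algebra_simps)
  also have "\<dots> \<le> norm v * L2_set ?D (index_lists k) + norm (v - u) * norm u ^ k"
    using L2_set_triangle_ineq[of "\<lambda>js. v $ hd js * ?D (tl js)"
        "\<lambda>js. (v - u) $ hd js * tensor_power u (tl js)" "index_lists (Suc k)"]
      L2_set_index_lists_product[of v ?D k]
      L2_set_index_lists_product[of "v - u" "tensor_power u" k]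
      L2_set_tensor_power[of u k]
    by simp
  also have "\<dots> \<le> R * (real k * R ^ (k - 1) * norm (v - u)) + norm (v - u) * R ^ k"
    using Suc u v R by (intro add_mono mult_mono power_mono order_refl) auto
  also have "\<dots> = real (Suc k) * R ^ (Suc k - 1) * norm (v - u)"
    by (cases k) (simp_all add: algebra_simps)
  finally show ?case .
qed

text \<open>
  The difference is the contraction of \<open>A\<close> with the difference of the tensor powers, and
  Cauchy--Schwarz in each row bounds it by the Frobenius norm.
\<close>
lemma tensor_apply_lipschitz:
  fixes u v :: "real ^ 'n::finite"
  assumes "1 \<le> m" and "norm u \<le> R" and "norm v \<le> R"
  shows "norm (tensor_apply m A v - tensor_apply m A u)
    \<le> real (m - 1) * frobenius_norm m A * R ^ (m - 2) * norm (v - u)"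
proof -
  obtain k where m: "m = Suc k" using assms(1) by (cases m) auto
  let ?D = "\<lambda>js. tensor_power v js - tensor_power u js"
  let ?S = "L2_set ?D (index_lists k)"
  let ?row = "\<lambda>i. L2_set (\<lambda>js. A (i # js)) (index_lists k)"
  have frob: "frobenius_norm m A = L2_set ?row UNIV"
    by (simp add: frobenius_norm_def m sum_index_lists_Suc L2_set_def real_sqrt_pow2 sum_nonneg)
  have comp: "\<bar>(tensor_apply m A v - tensor_apply m A u) $ i\<bar> \<le> ?row i * ?S" for i
  proof -
    have "(tensor_apply m A v - tensor_apply m A u) $ i
        = (\<Sum>js\<in>index_lists k. A (i # js) * ?D js)"
      by (simp add: tensor_apply_def m right_diff_distrib sum_subtractf)
    also have "\<bar>\<dots>\<bar> \<le> (\<Sum>js\<in>index_lists k. \<bar>A (i # js)\<bar> * \<bar>?D js\<bar>)"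
      by (rule order_trans[OF sum_abs]) (simp add: abs_mult)
    also have "\<dots> \<le> ?row i * ?S" by (rule L2_set_mult_ineq)
    finally show ?thesis .
  qed
  have "norm (tensor_apply m A v - tensor_apply m A u) \<le> L2_set (\<lambda>i. ?row i * ?S) UNIV"
    unfolding norm_vec_def using comp by (intro L2_set_mono) auto
  also have "\<dots> = frobenius_norm m A * ?S"
    by (simp add: frob L2_set_left_distrib[symmetric])
  also have "\<dots> \<le> frobenius_norm m A * (real k * R ^ (k - 1) * norm (v - u))"
    using L2_set_tensor_power_diff[OF assms(2,3)]
    by (intro mult_left_mono) (auto simp: frob)
  finally show ?thesis by (simp add: m mult_ac numeral_2_eq_2)
qed

lemma frobenius_norm_nonneg: "0 \<le> frobenius_norm m A"
  by (simp add: frobenius_norm_def sum_nonneg)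

section \<open>Lipschitz continuity of the Fischer--Burmeister map\<close>

lemma phi_FB_lipschitz: "\<bar>phi_FB a b - phi_FB c d\<bar> \<le> 2 * \<bar>a - c\<bar> + 2 * \<bar>b - d\<bar>"
proof -
  have "\<bar>norm (a, b) - norm (c, d)\<bar> \<le> norm ((a, b) - (c, d))"
    by (rule norm_triangle_ineq3)
  also have "\<dots> \<le> \<bar>a - c\<bar> + \<bar>b - d\<bar>"
    using sqrt_sum_squares_le_sum_abs[of "a - c" "b - d"] by (simp add: norm_Pair)
  finally have "\<bar>sqrt (a\<^sup>2 + b\<^sup>2) - sqrt (c\<^sup>2 + d\<^sup>2)\<bar> \<le> \<bar>a - c\<bar> + \<bar>b - d\<bar>"
    by (simp add: norm_Pair)
  then show ?thesis unfolding phi_FB_def by (smt (verit))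
qed

lemma Phi_FB_lipschitz:
  fixes u v :: "real ^ 'n::finite"
  assumes "1 \<le> m" and "norm u \<le> R" and "norm v \<le> R"
  shows "norm (Phi_FB m A q v - Phi_FB m A q u)
    \<le> 2 * (1 + real (m - 1) * frobenius_norm m A * R ^ (m - 2)) * norm (v - u)"
proof -
  let ?a = "\<lambda>i. norm ((v - u) $ i)"
  let ?b = "\<lambda>i. norm ((tensor_apply m A v - tensor_apply m A u) $ i)"
  have "norm (Phi_FB m A q v - Phi_FB m A q u) \<le> L2_set (\<lambda>i. 2 * ?a i + 2 * ?b i) UNIV"
    unfolding norm_vec_def
  proof (rule L2_set_mono)
    fix i
    show "norm ((Phi_FB m A q v - Phi_FB m A q u) $ i) \<le> 2 * ?a i + 2 * ?b i"
      using phi_FB_lipschitz[of "v $ i" "(q + tensor_apply m A v) $ i"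
          "u $ i" "(q + tensor_apply m A u) $ i"]
      by (simp add: Phi_FB_def)
  qed auto
  also have "\<dots> \<le> 2 * norm (v - u) + 2 * norm (tensor_apply m A v - tensor_apply m A u)"
    by (rule order_trans[OF L2_set_triangle_ineq])
       (simp add: norm_vec_def L2_set_right_distrib)
  also have "\<dots> \<le> 2 * (1 + real (m - 1) * frobenius_norm m A * R ^ (m - 2)) * norm (v - u)"
    using tensor_apply_lipschitz[OF assms, of A] by (simp add: algebra_simps)
  finally show ?thesis .
qed

section \<open>The first-order condition at a local minimizer\<close>

text \<open>A concave function lies below its tangents.\<close>
lemma powr_tangent_bound:
  fixes x s p :: real
  assumes "0 < s" and "s < x" and "0 < p" and "p < 1"
  shows "(x - s) powr p \<le> x powr p - p * x powr (p - 1) * s"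
proof -
  have "\<exists>z. x - s < z \<and> z < x \<and> x powr p - (x - s) powr p = (x - (x - s)) * (p * z powr (p - 1))"
  proof (rule MVT2)
    show "x - s < x" using assms by simp
    fix y assume "x - s \<le> y" "y \<le> x"
    then show "((\<lambda>y. y powr p) has_real_derivative p * y powr (p - 1)) (at y)"
      using assms by (intro has_real_derivative_powr) auto
  qed
  then obtain z where z: "x - s < z" "z < x"
    "x powr p - (x - s) powr p = s * (p * z powr (p - 1))" by auto
  have "x powr (p - 1) \<le> z powr (p - 1)"
    using z assms by (intro powr_mono2') auto
  then have "p * x powr (p - 1) * s \<le> s * (p * z powr (p - 1))"
    using assms by (simp add: mult_ac)
  with z(3) show ?thesis by linarith
qed

text \<open>
  Shrinking \<open>\<bar>u\<^sub>i\<bar>\<close> by \<open>s\<close> stays inside the ball of radius \<open>\<parallel>u\<parallel>\<close>, so a single Lipschitz constant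
  serves for all \<open>s\<close>; the limit \<open>s \<rightarrow> 0\<close> then removes the quadratic term.
\<close>
lemma local_minimizer_component_bound:
  fixes u q :: "real ^ 'n::finite"
  assumes "1 \<le> m" and p: "0 < p" "p < 1" and "0 < t"
    and min: "u \<in> local_minimizers (FB_objective m A q p t)"
    and R: "norm u \<le> R" and nz: "u $ i \<noteq> 0"
  shows "t * p * \<bar>u $ i\<bar> powr (p - 1)
    \<le> 2 * (1 + real (m - 1) * frobenius_norm m A * R ^ (m - 2)) * norm (Phi_FB m A q u)"
proof -
  define K where "K = 2 * (1 + real (m - 1) * frobenius_norm m A * R ^ (m - 2))"
  define v where "v s = u - (s * sgn (u $ i)) *\<^sub>R axis i 1" for s
  define c where "c = t * p * \<bar>u $ i\<bar> powr (p - 1)"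
  let ?f = "FB_objective m A q p t"
  let ?N = "\<lambda>w. norm (Phi_FB m A q w)"
  have "0 \<le> R" using R norm_ge_zero order_trans by blast
  then have "0 \<le> K" by (simp add: K_def frobenius_norm_nonneg)
  have v_same: "v s $ j = u $ j" if "j \<noteq> i" for s j
    using that by (simp add: v_def axis_def)
  have v_i: "\<bar>v s $ i\<bar> = \<bar>u $ i\<bar> - s" if "0 < s" "s < \<bar>u $ i\<bar>" for s
    using that by (auto simp: v_def axis_def sgn_if)
  have bound: "c \<le> K * ?N u + K\<^sup>2 * s / 2"
    if s: "0 < s" "s < \<bar>u $ i\<bar>" and le: "?f u \<le> ?f (v s)" for s
  proof -
    have "norm (v s) \<le> norm u"
    proof (rule norm_le_componentwise_cart)
      fix j show "norm (v s $ j) \<le> norm (u $ j)"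
        using v_same v_i s by (cases "j = i") auto
    qed
    then have "norm (v s) \<le> R" using R by simp
    moreover have "norm (v s - u) = s"
      using s nz by (simp add: v_def abs_mult abs_sgn_eq)
    ultimately have "norm (Phi_FB m A q (v s) - Phi_FB m A q u) \<le> K * s"
      using Phi_FB_lipschitz[OF \<open>1 \<le> m\<close> R, of "v s" A q] by (simp add: K_def)
    then have "?N (v s) \<le> ?N u + K * s"
      using norm_triangle_sub[of "Phi_FB m A q (v s)" "Phi_FB m A q u"] by linarith
    then have "(?N (v s))\<^sup>2 \<le> (?N u + K * s)\<^sup>2"
      by (intro power_mono) auto
    then have smooth: "(?N (v s))\<^sup>2 \<le> (?N u)\<^sup>2 + 2 * s * (K * ?N u + K\<^sup>2 * s / 2)"
      by (simp add: power2_eq_square algebra_simps)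
    have split: "p_norm_pow p w = \<bar>w $ i\<bar> powr p + (\<Sum>j\<in>UNIV - {i}. \<bar>w $ j\<bar> powr p)"
      for w :: "real ^ 'n"
      by (simp add: p_norm_pow_def sum.remove)
    have "(\<Sum>j\<in>UNIV - {i}. \<bar>v s $ j\<bar> powr p) = (\<Sum>j\<in>UNIV - {i}. \<bar>u $ j\<bar> powr p)"
      using v_same by (intro sum.cong) auto
    then have "p_norm_pow p (v s) \<le> p_norm_pow p u - p * \<bar>u $ i\<bar> powr (p - 1) * s"
      using powr_tangent_bound[OF s p] by (simp add: split v_i[OF s])
    then have "t * p_norm_pow p (v s) \<le> t * (p_norm_pow p u - p * \<bar>u $ i\<bar> powr (p - 1) * s)"
      using \<open>0 < t\<close> by (intro mult_left_mono) auto
    then have penalty: "t * p_norm_pow p (v s) \<le> t * p_norm_pow p u - s * c"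
      by (simp add: c_def algebra_simps)
    have "s * c \<le> s * (K * ?N u + K\<^sup>2 * s / 2)"
      using smooth penalty le by (simp add: FB_objective_def)
    with s show ?thesis by simp
  qed
  have "((\<lambda>s. v s) \<longlongrightarrow> u - (0 * sgn (u $ i)) *\<^sub>R axis i 1) (at_right 0)"
    unfolding v_def by (intro tendsto_intros)
  then have "filterlim v (nhds u) (at_right 0)" by simp
  then have "\<forall>\<^sub>F s in at_right 0. ?f u \<le> ?f (v s)"
    using min unfolding local_minimizers_def filterlim_iff by blast
  moreover have "\<forall>\<^sub>F s in at_right 0. s \<in> {0<..<\<bar>u $ i\<bar>}"
    using nz by (intro eventually_at_right_real) simp
  ultimately have "\<forall>\<^sub>F s in at_right 0. c \<le> K * ?N u + K\<^sup>2 * s / 2"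
    by eventually_elim (use bound in auto)
  moreover have "((\<lambda>s. K * ?N u + K\<^sup>2 * s / 2) \<longlongrightarrow> K * ?N u + K\<^sup>2 * 0 / 2) (at_right 0)"
    by (intro tendsto_intros) simp_all
  ultimately have "c \<le> K * ?N u + K\<^sup>2 * 0 / 2"
    by (intro tendsto_lowerbound) auto
  then show ?thesis by (simp add: c_def K_def)
qed

section \<open>Lower bound on the nonzero entries\<close>

lemma p_norm_pow_nonneg: "0 \<le> p_norm_pow p u"
  by (simp add: p_norm_pow_def sum_nonneg)

lemma card_nonzero_le_p_norm_pow:
  fixes u :: "real ^ 'n::finite"
  assumes "0 \<le> p" and "0 \<le> l" and "\<And>i. u $ i \<noteq> 0 \<Longrightarrow> l \<le> \<bar>u $ i\<bar>"
  shows "real (card {i. u $ i \<noteq> 0}) * l powr p \<le> p_norm_pow p u"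
proof -
  have "real (card {i. u $ i \<noteq> 0}) * l powr p = (\<Sum>i\<in>{i. u $ i \<noteq> 0}. l powr p)" by simp
  also have "\<dots> \<le> (\<Sum>i\<in>{i. u $ i \<noteq> 0}. \<bar>u $ i\<bar> powr p)"
    using assms by (intro sum_mono powr_mono2) auto
  also have "\<dots> \<le> p_norm_pow p u"
    unfolding p_norm_pow_def by (intro sum_mono2) auto
  finally show ?thesis .
qed

theorem theorem3p8:
  fixes m :: nat and A :: "'n::finite tensor" and q u0 u :: "real ^ 'n"
    and p t \<mu> L :: real and f :: "real ^ 'n \<Rightarrow> real"
  assumes "m \<ge> 2"
    and "symmetric_tensor m A"
    and "0 < p" and "p < 1"
    and "t > 0"
    and "f = FB_objective m A q p t"
    and "\<forall>v \<in> local_minimizers f. norm v \<le> \<mu>"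
    and "u \<in> local_minimizers f"
    and "f u \<le> f u0"
    and "L = (t * p / (2 * sqrt 2 * (1 + real (m - 1) * frobenius_norm m A * \<mu> ^ (m - 2))
                        * sqrt (f u0))) powr (1 / (1 - p))"
  shows "(\<forall>i. u $ i \<in> {-L<..<L} \<longrightarrow> u $ i = 0)
    \<and> real (card {i. u $ i \<noteq> 0}) \<le> f u0 / (t * L powr p)"
proof -
  let ?C = "1 + real (m - 1) * frobenius_norm m A * \<mu> ^ (m - 2)"
  let ?D = "2 * sqrt 2 * ?C * sqrt (f u0)"
  have u\<mu>: "norm u \<le> \<mu>" using assms by blast
  then have "0 \<le> \<mu>" using norm_ge_zero order_trans by blast
  then have C: "1 \<le> ?C" by (simp add: frobenius_norm_nonneg)
  have f_u: "f u = (norm (Phi_FB m A q u))\<^sup>2 / 2 + t * p_norm_pow p u"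
    by (simp add: assms(6) FB_objective_def)
  have pen: "t * p_norm_pow p u \<le> f u0"
    using assms(9) f_u zero_le_power2[of "norm (Phi_FB m A q u)"] by linarith
  have L0: "0 \<le> L" using assms(10) by simp
  have large: "L \<le> \<bar>u $ i\<bar>" if nz: "u $ i \<noteq> 0" for i
  proof -
    have "norm (Phi_FB m A q u) \<le> sqrt (2 * f u0)"
      using assms(5,9) f_u p_norm_pow_nonneg[of p u]
      by (intro real_le_rsqrt) (smt (verit) mult_nonneg_nonneg field_sum_of_halves)
    then have "2 * ?C * norm (Phi_FB m A q u) \<le> 2 * ?C * sqrt (2 * f u0)"
      using C by (intro mult_left_mono) auto
    moreover have "t * p * \<bar>u $ i\<bar> powr (p - 1) \<le> 2 * ?C * norm (Phi_FB m A q u)"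
      using assms nz u\<mu> by (intro local_minimizer_component_bound) auto
    moreover have "2 * ?C * sqrt (2 * f u0) = ?D" by (simp add: real_sqrt_mult)
    ultimately have le_D: "t * p * \<bar>u $ i\<bar> powr (p - 1) \<le> ?D" by linarith
    have pos: "0 < t * p * \<bar>u $ i\<bar> powr (p - 1)" using assms nz by simp
    have inv: "\<bar>u $ i\<bar> powr (p - 1) * \<bar>u $ i\<bar> powr (1 - p) = 1"
      using nz by (simp flip: powr_add)
    have "t * p = t * p * \<bar>u $ i\<bar> powr (p - 1) * \<bar>u $ i\<bar> powr (1 - p)"
      by (simp add: mult.assoc inv)
    also have "\<dots> \<le> ?D * \<bar>u $ i\<bar> powr (1 - p)"
      using le_D by (intro mult_right_mono) auto
    finally have "t * p / ?D \<le> \<bar>u $ i\<bar> powr (1 - p)"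
      using pos le_D by (subst pos_divide_le_eq) (auto simp: mult.commute)
    moreover have "0 \<le> t * p / ?D"
      using assms(3,5) pos le_D by (intro divide_nonneg_nonneg mult_nonneg_nonneg[of t p]) linarith+
    ultimately have "L \<le> (\<bar>u $ i\<bar> powr (1 - p)) powr (1 / (1 - p))"
      unfolding assms(10) using \<open>p < 1\<close> by (intro powr_mono2) simp_all
    then show ?thesis using nz \<open>p < 1\<close> by (simp add: powr_powr)
  qed
  have count: "real (card {i. u $ i \<noteq> 0}) \<le> f u0 / (t * L powr p)"
  proof (cases "f u0 = 0")
    \<comment> \<open>Here \<open>L\<close> and the bound are both \<open>0\<close> by division by zero, and \<open>u\<close> vanishes.\<close>
    case True
    then have "p_norm_pow p u \<le> 0" using pen \<open>t > 0\<close> by (simp add: mult_le_0_iff)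
    then have "p_norm_pow p u = 0" using p_norm_pow_nonneg[of p u] by linarith
    then have "{i. u $ i \<noteq> 0} = {}"
      by (auto simp: p_norm_pow_def sum_nonneg_eq_0_iff)
    with True show ?thesis by simp
  next
    case False
    have "0 \<le> t * p_norm_pow p u" using \<open>t > 0\<close> p_norm_pow_nonneg[of p u] by simp
    then have "0 < f u0" using pen False by linarith
    then have "0 < t * p / ?D" using C assms by simp
    then have "0 < L" unfolding assms(10) by (metis powr_gt_zero less_irrefl)
    have "t * (real (card {i. u $ i \<noteq> 0}) * L powr p) \<le> t * p_norm_pow p u"
      using card_nonzero_le_p_norm_pow[of p L u] large assms L0 by (intro mult_left_mono) auto
    then have "t * (real (card {i. u $ i \<noteq> 0}) * L powr p) \<le> f u0" using pen by (rule order_trans)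
    with \<open>0 < L\<close> \<open>t > 0\<close> show ?thesis by (simp add: pos_le_divide_eq mult_ac)
  qed
  show ?thesis using large count by fastforce
qed

end
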